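(* Let $A\in\mathbb{X}^{n\times n}$ be a matrix with spectral radius $\lambda>\mathsf{0}$, let $B\in\mathbb{X}^{n\times n}$ be a matrix with $\mathrm{Tr}(B)\leq\mathsf{1}$, and let $p,g\in\mathbb{X}^{n}$ be vectors. Consider the problem of minimizing $$x^{-}Ax\oplus x^{-}p$$ over all regular vectors $x\in\mathbb{X}^{n}$ subject to the constraint $Bx\oplus g\leq x$. Denote $$\theta=\lambda\oplus\bigoplus_{k=1}^{n-1}\ \bigoplus_{1\leq i_{1}+\cdots+i_{k}\leq n-k}\left(\mathrm{tr}(AB^{i_{1}}\cdots AB^{i_{k}})\right)^{1/k},$$ where the inner sum is over all tuples $(i_1,\ldots,i_k)$ of nonnegative integers satisfying the indicated condition. Then the minimum is equal to $\theta$, and all regular solutions of the problem are given by $$x=(\theta^{-1}A\oplus B)^{\ast}u,\qquad u\geq\theta^{-1}p\oplus g;$$ that is, a regular vector $x\in\mathbb{X}^{n}$ is a solution of the constrained problem if and only if $x=(\theta^{-1}A\oplus B)^{\ast}u$ for some $u\in\mathbb{X}^{n}$ with $u\geq\theta^{-1}p\oplus g$.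
   Context: $\langle\mathbb{X},\mathsf{0},\mathsf{1},\oplus,\otimes\rangle$ is an idempotent semifield: $\oplus$ and $\otimes$ are associative and commutative, with neutral elements $\mathsf{0}$ (zero) and $\mathsf{1}$ (identity) respectively; $\otimes$ distributes over $\oplus$ and $\mathsf{0}$ is absorbing for $\otimes$; addition is idempotent ($x\oplus x=x$); every $x\neq\mathsf{0}$ has a multiplicative inverse $x^{-1}$. The sign $\otimes$ is omitted. Integer powers are in the sense of $\otimes$, and the semifield is assumed radicable (powers with rational exponents exist), with $\mathsf{0}^{p}=\mathsf{0}$ for $p>0$. The order is $x\leq y$ iff $x\oplus y=y$, and it is assumed to be total; minimization is with respect to this order. Empty sums equal $\mathsf{0}$. Matrices and vectors over $\mathbb{X}$ are added and multiplied by the usual rules with $\oplus,\otimes$ in place of $+,\times$; $\mathbb{X}^{n}$ is the set of column vectors of order $n$; inequalities between vectors are entrywise. A vector is regular if none of its entries is $\mathsf{0}$. For a nonzero column vector $x=(x_i)$, the multiplicative conjugate transpose $x^{-}=(x_i^{-})$ is the row vector with $x_i^{-}=x_i^{-1}$ if $x_i\neq\mathsf{0}$ and $x_i^{-}=\mathsf{0}$ otherwise. $I$ is the identity matrix ($\mathsf{1}$ on the diagonal, $\mathsf{0}$ elsewhere), $A^{0}=I$, $A^{k}=A^{k-1}A$. For $A=(a_{ij})\in\mathbb{X}^{n\times n}$: $\mathrm{tr}A=a_{11}\oplus\cdots\oplus a_{nn}$, $\mathrm{Tr}(A)=\mathrm{tr}A\oplus\mathrm{tr}A^{2}\oplus\cdots\oplus\mathrm{tr}A^{n}$,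 and $A^{\ast}=I\oplus A\oplus\cdots\oplus A^{n-1}$. A scalar $\lambda\in\mathbb{X}$ is an eigenvalue of $A$ if $Ax=\lambda x$ for some nonzero $x\in\mathbb{X}^{n}$; the spectral radius of $A$ is its maximal eigenvalue, which is given by $\lambda=\bigoplus_{m=1}^{n}\left(\mathrm{tr}(A^{m})\right)^{1/m}$. *)

theory Defs
  imports "HOL-Analysis.Analysis"
begin

text \<open>
  Semifield addition and multiplication are written \<open>+\<close> and \<open>*\<close>, so that the sums, powers and
  matrix operations of the library are the tropical ones. Only \<open>inverse x\<close> for \<open>x \<noteq> 0\<close> is
  specified. The axiom \<open>0 \<noteq> 1\<close>, inherited from \<^class>\<open>comm_semiring_1\<close>, excludes just the
  one-element structure, in which no element is greater than \<open>0\<close>.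
\<close>

class radicable_idempotent_semifield = comm_semiring_1 + inverse + linorder +
  assumes add_idempotent: "x + x = x"
    and semifield_left_inverse: "x \<noteq> 0 \<Longrightarrow> inverse x * x = 1"
    and semifield_divide_inverse: "x / y = x * inverse y"
    and le_iff_add_absorb: "x \<le> y \<longleftrightarrow> x + y = y"
    and radicable: "0 < n \<Longrightarrow> \<exists>y. y ^ n = x"

lemma semifield_zero_le: "0 \<le> (x :: 'a :: radicable_idempotent_semifield)"
  by (simp add: le_iff_add_absorb)

lemma semifield_mult_left_mono:
  "x \<le> y \<Longrightarrow> z * x \<le> z * (y :: 'a :: radicable_idempotent_semifield)"
  by (simp add: le_iff_add_absorb flip: distrib_left)

lemma semifield_mult_left_cancel:
  fixes x y z :: "'a :: radicable_idempotent_semifield"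
  assumes "z \<noteq> 0" "z * x = z * y"
  shows "x = y"
  by (metis assms mult.assoc mult_1 semifield_left_inverse)

lemma semifield_power_strict_mono:
  fixes x y :: "'a :: radicable_idempotent_semifield"
  assumes "x < y"
  shows "x ^ Suc n < y ^ Suc n"
proof (induction n)
  case 0
  show ?case using assms by simp
next
  case (Suc n)
  have y: "y \<noteq> 0" using assms semifield_zero_le[of x] by auto
  have "x ^ Suc (Suc n) \<le> y * x ^ Suc n"
    using semifield_mult_left_mono[of x y "x ^ Suc n"] assms by (simp add: mult.commute)
  also have "\<dots> < y * y ^ Suc n"
    using semifield_mult_left_mono[of "x ^ Suc n" "y ^ Suc n" y]
      semifield_mult_left_cancel[OF y, of "x ^ Suc n" "y ^ Suc n"] Suc
    by (metis less_le)
  finally show ?case by simp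
qed

lemma semifield_root_unique:
  fixes x :: "'a :: radicable_idempotent_semifield"
  assumes "0 < n"
  shows "\<exists>!y. y ^ n = x"
  using radicable[OF assms] assms
  by (metis gr0_conv_Suc less_irrefl neqE semifield_power_strict_mono)

text \<open>The power \<open>x\<^bsup>1/n\<^esup>\<close>, for \<open>n > 0\<close>.\<close>

definition nth_root :: "nat \<Rightarrow> 'a \<Rightarrow> 'a :: radicable_idempotent_semifield" where
  "nth_root n x = (THE y. y ^ n = x)"

lemma nth_root_power: "0 < n \<Longrightarrow> nth_root n x ^ n = x"
  unfolding nth_root_def by (rule theI') (rule semifield_root_unique)

lemma nth_root_zero: "0 < n \<Longrightarrow> nth_root n 0 = 0"
  by (metis nth_root_power semifield_root_unique zero_power)

text \<open>The power \<open>^\<close> of the library acts entrywise on matrices.\<close>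

primrec matrix_power :: "'a :: semiring_1 ^ 'n ^ 'n \<Rightarrow> nat \<Rightarrow> 'a ^ 'n ^ 'n" where
  "matrix_power A 0 = mat 1"
| "matrix_power A (Suc k) = matrix_power A k ** A"

definition Tr :: "'a :: semiring_1 ^ 'n ^ 'n \<Rightarrow> 'a" where
  "Tr A = (\<Sum>m = 1..CARD('n). trace (matrix_power A m))"

definition matrix_star :: "'a :: semiring_1 ^ 'n ^ 'n \<Rightarrow> 'a ^ 'n ^ 'n" where
  "matrix_star A = (\<Sum>k < CARD('n). matrix_power A k)"

definition regular_vec :: "'a :: zero ^ 'n \<Rightarrow> bool" where
  "regular_vec x \<longleftrightarrow> (\<forall>i. x $ i \<noteq> 0)"

text \<open>Row vectors have the same type as column vectors; a row times a column is a
  \<^const>\<open>scalar_product\<close>.\<close>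

definition conj_transpose :: "'a :: radicable_idempotent_semifield ^ 'n \<Rightarrow> 'a ^ 'n" where
  "conj_transpose x = (\<chi> i. if x $ i = 0 then 0 else inverse (x $ i))"

definition is_eigenvalue :: "'a :: semiring_1 ^ 'n ^ 'n \<Rightarrow> 'a \<Rightarrow> bool" where
  "is_eigenvalue A l \<longleftrightarrow> (\<exists>x. x \<noteq> 0 \<and> A *v x = l *s x)"

definition is_spectral_radius ::
    "'a :: radicable_idempotent_semifield ^ 'n ^ 'n \<Rightarrow> 'a \<Rightarrow> bool" where
  "is_spectral_radius A l \<longleftrightarrow> is_eigenvalue A l \<and> (\<forall>m. is_eigenvalue A m \<longrightarrow> m \<le> l)"

definition objective ::
    "'a :: radicable_idempotent_semifield ^ 'n ^ 'n \<Rightarrow> 'a ^ 'n \<Rightarrow> 'a ^ 'n \<Rightarrow> 'a" where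
  "objective A p x =
     scalar_product (conj_transpose x) (A *v x) + scalar_product (conj_transpose x) p"

definition feasible ::
    "'a :: radicable_idempotent_semifield ^ 'n ^ 'n \<Rightarrow> 'a ^ 'n \<Rightarrow> 'a ^ 'n \<Rightarrow> bool" where
  "feasible B g x \<longleftrightarrow> regular_vec x \<and> B *v x + g \<le> x"

text \<open>The product \<open>A B\<^bsup>i\<^sub>1\<^esup> \<dots> A B\<^bsup>i\<^sub>k\<^esup>\<close> for the tuple \<open>[i\<^sub>1, \<dots>, i\<^sub>k]\<close>.\<close>

primrec mixed_product ::
    "'a :: semiring_1 ^ 'n ^ 'n \<Rightarrow> 'a ^ 'n ^ 'n \<Rightarrow> nat list \<Rightarrow> 'a ^ 'n ^ 'n" where
  "mixed_product A B [] = mat 1"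
| "mixed_product A B (i # is) = A ** matrix_power B i ** mixed_product A B is"

definition exponent_tuples :: "nat \<Rightarrow> nat \<Rightarrow> nat list set" where
  "exponent_tuples n k = {is. length is = k \<and> 1 \<le> sum_list is \<and> sum_list is \<le> n - k}"

text \<open>Finiteness matters because a sum over an infinite set is \<open>0\<close> by convention.\<close>

lemma finite_exponent_tuples: "finite (exponent_tuples n k)"
proof (rule finite_subset)
  show "exponent_tuples n k \<subseteq> {is. set is \<subseteq> {..n} \<and> length is = k}"
    using member_le_sum_list by (fastforce simp: exponent_tuples_def)
  show "finite {is. set is \<subseteq> {..n} \<and> length is = k}"
    by (rule finite_lists_length_eq) simp
qed

definition theta ::
    "'a :: radicable_idempotent_semifield \<Rightarrow> 'a ^ 'n ^ 'n \<Rightarrow> 'a ^ 'n ^ 'n \<Rightarrow> 'a" where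
  "theta l A B =
     l + (\<Sum>k = 1..CARD('n) - 1. \<Sum>is \<in> exponent_tuples CARD('n) k.
            nth_root k (trace (mixed_product A B is)))"

end

theory Submission
  imports Defs
begin

text \<open>
  For a regular vector \<open>x\<close>, division by the entries of \<open>x\<close> turns the inequality
  \<open>objective A p x \<le> c\<close> into the vector inequalities \<open>A x \<le> c x\<close> and \<open>p \<le> c x\<close>. With
  \<open>c \<noteq> 0\<close>, the feasible vectors of objective at most \<open>c\<close> are therefore exactly the regular
  solutions of \<open>M x \<le> x\<close>, \<open>b \<le> x\<close>, where \<open>M = c\<inverse> A + B\<close> and \<open>b = c\<inverse> p + g\<close>
  (\<open>feasible_objective_le_iff\<close>). If \<open>Tr M \<le> 1\<close>, that is, if no closed walk of length at most
  \<open>n\<close> has weight above \<open>1\<close>, these solutions are the vectors \<open>M\<^sup>* u\<close> with \<open>u \<ge> b\<close>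
  (\<open>subinvariant_iff_star_image\<close>). The theorem thus reduces to two properties of \<open>\<theta>\<close>.

  No smaller value is possible (\<open>theta_le_of_subeigenvector\<close>). From \<open>A x \<le> c x\<close> and
  \<open>B x \<le> x\<close>, a product with \<open>k\<close> factors \<open>A\<close> and any number of factors \<open>B\<close> maps \<open>x\<close> below
  \<open>c\<^sup>k x\<close>, so its trace is at most \<open>c\<^sup>k\<close>. Hence \<open>c\<close> dominates every root in the definition of
  \<open>\<theta>\<close>; it dominates \<open>\<lambda>\<close> by comparison of an eigenvector with \<open>x\<close>.

  The value \<open>\<theta>\<close> makes the star available (\<open>Tr_scaled_sum_le_one\<close>). Expanding
  \<open>(\<theta>\<inverse> A + B)\<^sup>m\<close>, and using the cyclic invariance of the trace, leaves three kinds of terms: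
  the traces of \<open>B\<^sup>m\<close>, bounded by the hypothesis on \<open>B\<close>; the traces of
  \<open>A B\<^bsup>i\<^sub>1\<^esup> \<dots> A B\<^bsup>i\<^sub>k\<^esup>\<close> with some positive exponent, which occur in \<open>\<theta>\<close>; and the traces
  of \<open>A\<^sup>m\<close>. The last ones are at most \<open>\<lambda>\<^sup>m\<close>, because the greatest mean
  \<open>(tr A\<^sup>m)\<^bsup>1/m\<^esup>\<close>, when it is not \<open>0\<close>, is itself an eigenvalue
  (\<open>trace_matrix_power_le_spectral_radius\<close>): dividing \<open>A\<close> by this mean and taking the star
  gives a matrix with an eigenvector of \<open>A\<close> among its columns.
\<close>


section \<open>Order and roots in the semifield\<close>

lemma semifield_add_eq_max:
  fixes x y :: "'a :: radicable_idempotent_semifield"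
  shows "x + y = max x y"
  using linear[of x y] by (auto simp: le_iff_add_absorb max_def add.commute)

lemma semifield_add_le_iff:
  fixes x y z :: "'a :: radicable_idempotent_semifield"
  shows "x + y \<le> z \<longleftrightarrow> x \<le> z \<and> y \<le> z"
  by (simp add: semifield_add_eq_max)

instance radicable_idempotent_semifield \<subseteq> ordered_comm_semiring
  by standard (auto simp: semifield_add_eq_max max.coboundedI2 intro: semifield_mult_left_mono)

instance radicable_idempotent_semifield \<subseteq> canonically_ordered_monoid_add
proof
  fix x y :: 'a
  show "x \<le> y \<longleftrightarrow> (\<exists>z. y = x + z)"
    by (metis le_iff_add_absorb max.cobounded1 semifield_add_eq_max)
qed

lemma semifield_sum_le_iff:
  fixes f :: "'b \<Rightarrow> 'a :: radicable_idempotent_semifield"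
  assumes "finite S"
  shows "sum f S \<le> c \<longleftrightarrow> (\<forall>x\<in>S. f x \<le> c)"
  using assms by (induction S) (auto simp: semifield_add_le_iff)

lemma semifield_member_le_sum:
  fixes f :: "'b \<Rightarrow> 'a :: radicable_idempotent_semifield"
  assumes "finite S" "x \<in> S"
  shows "f x \<le> sum f S"
  using assms semifield_sum_le_iff by blast

lemma semifield_sum_attained:
  fixes f :: "'b \<Rightarrow> 'a :: radicable_idempotent_semifield"
  assumes "finite S" "S \<noteq> {}"
  obtains x where "x \<in> S" "sum f S = f x"
proof -
  have "\<exists>x\<in>S. sum f S = f x"
    using assms by (induction S rule: finite_ne_induct) (auto simp: semifield_add_eq_max max_def)
  then show ?thesis using that by blast
qed

lemma semifield_inverse_mult_cancel:
  fixes c x :: "'a :: radicable_idempotent_semifield"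
  assumes "c \<noteq> 0"
  shows "inverse c * (c * x) = x" "c * (inverse c * x) = x"
proof -
  show "inverse c * (c * x) = x"
    by (simp add: semifield_left_inverse[OF assms] flip: mult.assoc)
  then show "c * (inverse c * x) = x"
    by (simp only: mult.left_commute)
qed

lemma semifield_inverse_mult_le_iff:
  fixes c x y :: "'a :: radicable_idempotent_semifield"
  assumes "c \<noteq> 0"
  shows "inverse c * x \<le> y \<longleftrightarrow> x \<le> c * y"
  by (metis assms semifield_inverse_mult_cancel semifield_mult_left_mono)

lemma semifield_mult_le_cancel:
  fixes c x y :: "'a :: radicable_idempotent_semifield"
  assumes "c \<noteq> 0"
  shows "x * c \<le> y * c \<longleftrightarrow> x \<le> y"
  using semifield_inverse_mult_le_iff[OF assms, of "c * x" y] semifield_inverse_mult_cancel[OF assms]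
  by (simp add: mult.commute)

lemma semifield_no_zero_divisors:
  fixes x y :: "'a :: radicable_idempotent_semifield"
  assumes "x \<noteq> 0" "y \<noteq> 0"
  shows "x * y \<noteq> 0"
  using assms semifield_mult_left_cancel by (metis mult_zero_right)

lemma semifield_inverse_power_mult_le_iff:
  fixes c x y :: "'a :: radicable_idempotent_semifield"
  assumes "c \<noteq> 0"
  shows "inverse c ^ n * x \<le> y \<longleftrightarrow> x \<le> c ^ n * y"
proof (induction n arbitrary: x)
  case (Suc n)
  show ?case
    using Suc[of "inverse c * x"] semifield_inverse_mult_le_iff[OF assms, of x "c ^ n * y"]
    by (simp add: mult_ac)
qed simp

lemma semifield_power_mono:
  fixes x y :: "'a :: radicable_idempotent_semifield"
  assumes "x \<le> y"
  shows "x ^ n \<le> y ^ n"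
  by (induction n) (simp_all add: assms mult_mono)

lemma nth_root_le_iff:
  fixes x y :: "'a :: radicable_idempotent_semifield"
  assumes "0 < n"
  shows "nth_root n x \<le> y \<longleftrightarrow> x \<le> y ^ n"
proof -
  have "strict_mono (\<lambda>z :: 'a. z ^ n)"
    using assms semifield_power_strict_mono by (metis gr0_conv_Suc strict_monoI)
  from strict_mono_less_eq[OF this] show ?thesis
    by (metis nth_root_power[OF assms])
qed


section \<open>Matrices over the semifield\<close>

lemma matrix_power_add: "matrix_power M (a + b) = matrix_power M a ** matrix_power M b"
  by (induction b) (simp_all add: matrix_mul_assoc)

lemma matrix_power_Suc_left: "matrix_power M (Suc k) = M ** matrix_power M k"
  using matrix_power_add[of M 1 k] by simp

lemma trace_le_iff:
  fixes M :: "'a :: radicable_idempotent_semifield ^ 'n ^ 'n"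
  shows "trace M \<le> c \<longleftrightarrow> (\<forall>i. M $ i $ i \<le> c)"
  by (simp add: trace_def semifield_sum_le_iff)

lemma Tr_le_iff:
  fixes M :: "'a :: radicable_idempotent_semifield ^ 'n ^ 'n"
  shows "Tr M \<le> c \<longleftrightarrow> (\<forall>m\<in>{1..CARD('n)}. trace (matrix_power M m) \<le> c)"
  by (simp add: Tr_def semifield_sum_le_iff)

lemma matrix_mult_entry_ge:
  fixes M N :: "'a :: radicable_idempotent_semifield ^ 'n ^ 'n"
  shows "M $ i $ k * N $ k $ j \<le> (M ** N) $ i $ j"
  using semifield_member_le_sum[of UNIV k "\<lambda>k. M $ i $ k * N $ k $ j"]
  by (simp add: matrix_matrix_mult_def)

lemma matrix_mult_entry_attained:
  fixes M N :: "'a :: radicable_idempotent_semifield ^ 'n ^ 'n"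
  obtains k where "(M ** N) $ i $ j = M $ i $ k * N $ k $ j"
  using semifield_sum_attained[of UNIV "\<lambda>k. M $ i $ k * N $ k $ j"]
  unfolding matrix_matrix_mult_def by auto

lemma matrix_vector_mult_mono:
  fixes M :: "'a :: radicable_idempotent_semifield ^ 'n ^ 'm"
  assumes "x \<le> y"
  shows "M *v x \<le> M *v y"
  using assms unfolding matrix_vector_mult_def less_eq_vec_def
  by (simp add: sum_mono semifield_mult_left_mono)

lemma matrix_vector_entry_ge:
  fixes M :: "'a :: radicable_idempotent_semifield ^ 'n ^ 'm"
  shows "M $ i $ k * x $ k \<le> (M *v x) $ i"
  using semifield_member_le_sum[of UNIV k "\<lambda>k. M $ i $ k * x $ k"]
  by (simp add: matrix_vector_mult_def)

lemma matrix_vector_smult: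
  fixes M :: "'a :: comm_semiring_1 ^ 'n ^ 'm"
  shows "M *v (c *s x) = c *s (M *v x)"
  by (simp add: vec_eq_iff matrix_vector_mult_def sum_distrib_left mult.left_commute)

lemma scaled_matrix_vector_mult:
  fixes M :: "'a :: comm_semiring_1 ^ 'n ^ 'm"
  shows "map_matrix ((*) c) M *v x = c *s (M *v x)"
  by (simp add: vec_eq_iff matrix_vector_mult_def sum_distrib_left mult.assoc)

lemma scaled_matrix_power:
  fixes M :: "'a :: comm_semiring_1 ^ 'n ^ 'n"
  shows "matrix_power (map_matrix ((*) c) M) k $ i $ j = c ^ k * matrix_power M k $ i $ j"
proof (induction k arbitrary: j)
  case (Suc k)
  then show ?case by (simp add: matrix_matrix_mult_def sum_distrib_left mult_ac)
qed (simp add: mat_def)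

lemma trace_le_of_subeigenvector:
  fixes M :: "'a :: radicable_idempotent_semifield ^ 'n ^ 'n"
  assumes "regular_vec x" "M *v x \<le> c *s x"
  shows "trace M \<le> c"
  unfolding trace_le_iff
proof
  fix i
  have "M $ i $ i * x $ i \<le> (M *v x) $ i" by (rule matrix_vector_entry_ge)
  also have "\<dots> \<le> c * x $ i" using assms(2) by (simp add: less_eq_vec_def)
  finally show "M $ i $ i \<le> c"
    using assms(1) semifield_mult_le_cancel by (auto simp: regular_vec_def)
qed


section \<open>The star of a matrix without cycles above the identity\<close>

text \<open>
  Entries of a power are maxima of walk weights, and a finite maximum is attained. The entry must
  be nonzero because the power of exponent \<open>0\<close> has entries \<open>0\<close> that belong to no walk.
\<close>

lemma matrix_power_entry_walk:
  fixes M :: "'a :: radicable_idempotent_semifield ^ 'n ^ 'n"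
  assumes "matrix_power M m $ i $ j \<noteq> 0"
  obtains f where "f 0 = i" "f m = j" "matrix_power M m $ i $ j = (\<Prod>t<m. M $ f t $ f (Suc t))"
proof -
  have "\<exists>f. f 0 = i \<and> f m = j \<and> matrix_power M m $ i $ j = (\<Prod>t<m. M $ f t $ f (Suc t))"
    using assms
  proof (induction m arbitrary: j)
    case 0
    then have "i = j" by (auto simp: mat_def split: if_splits)
    then show ?case by (intro exI[of _ "\<lambda>_. i"]) (simp add: mat_def)
  next
    case (Suc m)
    obtain k where k: "(matrix_power M m ** M) $ i $ j = matrix_power M m $ i $ k * M $ k $ j"
      by (rule matrix_mult_entry_attained)
    with Suc.prems have "matrix_power M m $ i $ k \<noteq> 0" by auto
    from Suc.IH[OF this] obtain f where f: "f 0 = i" "f m = k"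
      "matrix_power M m $ i $ k = (\<Prod>t<m. M $ f t $ f (Suc t))" by blast
    let ?f = "f(Suc m := j)"
    have "(\<Prod>t<m. M $ f t $ f (Suc t)) = (\<Prod>t<m. M $ ?f t $ ?f (Suc t))"
      by (intro prod.cong) auto
    then show ?case
      using k f by (intro exI[of _ ?f]) auto
  qed
  then show ?thesis using that by blast
qed

lemma walk_weight_le_matrix_power:
  fixes M :: "'a :: radicable_idempotent_semifield ^ 'n ^ 'n"
  shows "(\<Prod>t = s..<s + d. M $ f t $ f (Suc t)) \<le> matrix_power M d $ f s $ f (s + d)"
proof (induction d)
  case (Suc d)
  have "(\<Prod>t = s..<s + Suc d. M $ f t $ f (Suc t))
      = (\<Prod>t = s..<s + d. M $ f t $ f (Suc t)) * M $ f (s + d) $ f (Suc (s + d))"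
    by simp
  also have "\<dots> \<le> matrix_power M d $ f s $ f (s + d) * M $ f (s + d) $ f (Suc (s + d))"
    using Suc by (intro mult_right_mono) auto
  also have "\<dots> \<le> matrix_power M (Suc d) $ f s $ f (s + Suc d)"
    using matrix_mult_entry_ge[of "matrix_power M d"] by simp
  finally show ?case .
qed (simp add: mat_def)

lemma matrix_star_entry:
  "matrix_star M $ i $ j = (\<Sum>k<CARD('n). matrix_power M k $ i $ j)"
  for M :: "'a :: semiring_1 ^ 'n ^ 'n"
  by (simp add: matrix_star_def)

lemma matrix_power_le_star:
  fixes M :: "'a :: radicable_idempotent_semifield ^ 'n ^ 'n"
  assumes "k < CARD('n)"
  shows "matrix_power M k $ i $ j \<le> matrix_star M $ i $ j"
  using assms semifield_member_le_sum[of "{..<CARD('n)}" k "\<lambda>k. matrix_power M k $ i $ j"]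
  by (simp add: matrix_star_entry)

text \<open>
  A walk of length \<open>n\<close> visits \<open>n + 1\<close> vertices, so it repeats one. The cycle between the two
  visits weighs at most \<open>1\<close>; cutting it out leaves a walk shorter than \<open>n\<close> of at least the
  same weight.
\<close>

lemma matrix_power_card_le_star:
  fixes M :: "'a :: radicable_idempotent_semifield ^ 'n ^ 'n"
  assumes "Tr M \<le> 1"
  shows "matrix_power M CARD('n) $ i $ j \<le> matrix_star M $ i $ j"
proof (cases "matrix_power M CARD('n) $ i $ j = 0")
  case False
  let ?n = "CARD('n)"
  obtain f where f: "f 0 = i" "f ?n = j"
    and walk: "matrix_power M ?n $ i $ j = (\<Prod>t<?n. M $ f t $ f (Suc t))"
    using matrix_power_entry_walk[OF False] .
  have "\<not> inj_on f {..?n}"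
    using card_inj_on_le[of f "{..?n}" UNIV] by auto
  then obtain s t where st: "s < t" "t \<le> ?n" "f s = f t"
    unfolding inj_on_def by (metis atMost_iff linorder_neqE_nat)
  let ?P = "\<lambda>a b. \<Prod>t = a..<b. M $ f t $ f (Suc t)"
  have walk_le: "?P a b \<le> matrix_power M (b - a) $ f a $ f b" if "a \<le> b" for a b
    using walk_weight_le_matrix_power[of M f a "b - a"] that by simp
  have "?P s t \<le> matrix_power M (t - s) $ f s $ f s"
    using walk_le[of s t] st by simp
  also have "\<dots> \<le> 1"
  proof -
    have "t - s \<in> {1..?n}" using st by auto
    then show ?thesis using assms unfolding Tr_le_iff trace_le_iff by blast
  qed
  finally have cycle: "?P s t \<le> 1" .
  have "matrix_power M ?n $ i $ j = ?P 0 s * ?P s t * ?P t ?n"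
    using st walk by (simp add: prod.atLeastLessThan_concat flip: atLeast0LessThan)
  also have "\<dots> \<le> ?P 0 s * 1 * ?P t ?n"
    by (intro mult_mono cycle) auto
  also have "\<dots> \<le> matrix_power M s $ i $ f s * matrix_power M (?n - t) $ f s $ j"
    using walk_le[of 0 s] walk_le[of t ?n] st f by (simp add: mult_mono)
  also have "\<dots> \<le> matrix_power M (s + (?n - t)) $ i $ j"
    unfolding matrix_power_add by (rule matrix_mult_entry_ge)
  also have "\<dots> \<le> matrix_star M $ i $ j"
    using st by (intro matrix_power_le_star) auto
  finally show ?thesis .
qed simp

lemma matrix_mult_star_entry:
  fixes M :: "'a :: radicable_idempotent_semifield ^ 'n ^ 'n"
  shows "(M ** matrix_star M) $ i $ j = (\<Sum>k<CARD('n). matrix_power M (Suc k) $ i $ j)"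
  unfolding matrix_power_Suc_left matrix_matrix_mult_def
  by (simp add: matrix_star_entry sum_distrib_left sum.swap[of _ UNIV])

lemma matrix_mult_star_le:
  fixes M :: "'a :: radicable_idempotent_semifield ^ 'n ^ 'n"
  assumes "Tr M \<le> 1"
  shows "(M ** matrix_star M) $ i $ j \<le> matrix_star M $ i $ j"
proof -
  have "matrix_power M (Suc k) $ i $ j \<le> matrix_star M $ i $ j" if "k < CARD('n)" for k
    using matrix_power_card_le_star[OF assms] matrix_power_le_star[of "Suc k" M] that
    by (metis Suc_lessI)
  then show ?thesis
    by (simp add: matrix_mult_star_entry semifield_sum_le_iff del: matrix_power.simps)
qed

lemma matrix_power_vector_le:
  fixes M :: "'a :: radicable_idempotent_semifield ^ 'n ^ 'n"
  assumes "M *v x \<le> x"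
  shows "matrix_power M k *v x \<le> x"
proof (induction k)
  case (Suc k)
  have "matrix_power M (Suc k) *v x = matrix_power M k *v (M *v x)"
    by (simp add: matrix_vector_mul_assoc)
  also have "\<dots> \<le> x"
    using matrix_vector_mult_mono[OF assms] Suc by (rule order_trans)
  finally show ?case .
qed simp

lemma matrix_star_vector:
  fixes M :: "'a :: radicable_idempotent_semifield ^ 'n ^ 'n"
  shows "(matrix_star M *v x) $ i = (\<Sum>k<CARD('n). (matrix_power M k *v x) $ i)"
  unfolding matrix_vector_mult_def
  by (simp add: matrix_star_entry sum_distrib_right sum.swap[of _ UNIV])

lemma le_matrix_star_vector:
  fixes M :: "'a :: radicable_idempotent_semifield ^ 'n ^ 'n"
  shows "x \<le> matrix_star M *v x"
proof -
  have "(matrix_power M 0 *v x) $ i \<le> (matrix_star M *v x) $ i" for i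
    unfolding matrix_star_vector by (rule semifield_member_le_sum) auto
  then show ?thesis by (simp add: less_eq_vec_def)
qed

text \<open>
  Every solution \<open>x\<close> is its own parameter: \<open>M x \<le> x\<close> makes all powers of \<open>M\<close>, and hence the
  star, map \<open>x\<close> below itself, while the star maps every vector above itself. Conversely,
  \<open>M M\<^sup>* \<le> M\<^sup>*\<close> makes each vector in the image of the star a solution.
\<close>

lemma subinvariant_iff_star_image:
  fixes M :: "'a :: radicable_idempotent_semifield ^ 'n ^ 'n"
  assumes "Tr M \<le> 1"
  shows "M *v x \<le> x \<and> b \<le> x \<longleftrightarrow> (\<exists>u. b \<le> u \<and> x = matrix_star M *v u)"
proof (intro iffI conjI)
  assume x: "M *v x \<le> x \<and> b \<le> x"
  have "(matrix_star M *v x) $ i \<le> x $ i" for i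
    using matrix_power_vector_le[of M x] x
    by (simp add: matrix_star_vector semifield_sum_le_iff less_eq_vec_def)
  then have "matrix_star M *v x \<le> x" by (simp add: less_eq_vec_def)
  then have "x = matrix_star M *v x"
    using le_matrix_star_vector by (rule antisym[rotated])
  with x show "\<exists>u. b \<le> u \<and> x = matrix_star M *v u" by blast
next
  assume "\<exists>u. b \<le> u \<and> x = matrix_star M *v u"
  then obtain u where u: "b \<le> u" "x = matrix_star M *v u" by blast
  show "b \<le> x" using u le_matrix_star_vector order_trans by blast
  have "(M ** matrix_star M) *v u \<le> matrix_star M *v u"
    using matrix_mult_star_le[OF assms]
    by (auto simp: matrix_vector_mult_def less_eq_vec_def intro!: sum_mono mult_right_mono)
  then show "M *v x \<le> x" by (simp add: u matrix_vector_mul_assoc)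
qed


section \<open>The spectral radius\<close>

text \<open>
  Scale \<open>x\<close> by the least \<open>d\<close> such that the eigenvector \<open>v\<close> lies below \<open>d x\<close>. The two vectors
  then agree at some index \<open>i\<close>, where \<open>l v\<^sub>i = (A v)\<^sub>i \<le> d (A x)\<^sub>i \<le> c d x\<^sub>i = c v\<^sub>i\<close>.
\<close>

lemma eigenvalue_le_of_subeigenvector:
  fixes A :: "'a :: radicable_idempotent_semifield ^ 'n ^ 'n"
  assumes "is_eigenvalue A l" "regular_vec x" "A *v x \<le> c *s x"
  shows "l \<le> c"
proof -
  obtain v where v: "v \<noteq> 0" "A *v v = l *s v"
    using assms(1) by (auto simp: is_eigenvalue_def)
  have x: "x $ i \<noteq> 0" for i using assms(2) by (simp add: regular_vec_def)
  define d where "d = (\<Sum>i\<in>UNIV. inverse (x $ i) * v $ i)"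
  have "inverse (x $ j) * v $ j \<le> d" for j
    unfolding d_def by (rule semifield_member_le_sum) auto
  then have le: "v $ j \<le> d * x $ j" for j
    using semifield_inverse_mult_le_iff[OF x[of j], of "v $ j" d] by (simp add: mult.commute)
  obtain i where "d = inverse (x $ i) * v $ i"
    using semifield_sum_attained[of UNIV "\<lambda>i. inverse (x $ i) * v $ i"] unfolding d_def by auto
  then have "d * x $ i = (inverse (x $ i) * x $ i) * v $ i" by (simp add: mult_ac)
  then have eq: "v $ i = d * x $ i"
    using semifield_left_inverse[OF x] by simp
  have "d \<noteq> 0"
  proof
    assume "d = 0"
    then have "v = 0" using le by (simp add: vec_eq_iff)
    with v show False by simp
  qed
  then have nz: "d * x $ i \<noteq> 0" using x by (rule semifield_no_zero_divisors)
  have "v \<le> d *s x" using le by (simp add: less_eq_vec_def)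
  then have "A *v v \<le> d *s (A *v x)"
    using matrix_vector_mult_mono matrix_vector_smult by metis
  then have "l * v $ i \<le> d * (A *v x) $ i"
    using v(2) by (simp add: less_eq_vec_def)
  also have "\<dots> \<le> d * (c * x $ i)"
    using assms(3) by (simp add: less_eq_vec_def semifield_mult_left_mono)
  finally show "l \<le> c"
    using semifield_mult_le_cancel[OF nz, of l c] eq by (simp add: mult_ac)
qed

text \<open>
  The eigenvector is column \<open>i\<close> of the star. The star and its product with \<open>M\<close> can differ only in
  the term \<open>I\<close>, and in column \<open>i\<close> that term is absorbed by the closed walk of weight \<open>1\<close>.
\<close>

lemma one_eigenvalue_of_critical_cycle:
  fixes M :: "'a :: radicable_idempotent_semifield ^ 'n ^ 'n"
  assumes "Tr M \<le> 1" and m: "m \<in> {1..CARD('n)}" "matrix_power M m $ i $ i = 1"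
  shows "is_eigenvalue M 1"
proof -
  define v where "v = (\<chi> j. matrix_star M $ j $ i)"
  have Mv: "(M *v v) $ j = (M ** matrix_star M) $ j $ i" for j
    by (simp add: v_def matrix_vector_mult_def matrix_matrix_mult_def)
  have pow: "matrix_power M k $ j $ i \<le> (M ** matrix_star M) $ j $ i"
    if "k \<in> {1..CARD('n)}" for j k
    using that semifield_member_le_sum[of "{..<CARD('n)}" "k - 1" "\<lambda>k. matrix_power M (Suc k) $ j $ i"]
    unfolding matrix_mult_star_entry by force
  \<comment> \<open>Off the diagonal the identity is \<open>0\<close>; at \<open>(i, i)\<close> the critical cycle supplies its \<open>1\<close>.\<close>
  have zero: "matrix_power M 0 $ j $ i \<le> (M ** matrix_star M) $ j $ i" for j
    using pow[OF m(1), of j] m(2) by (cases "j = i") (auto simp: mat_def)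
  have "matrix_star M $ j $ i \<le> (M ** matrix_star M) $ j $ i" for j
  proof -
    have "matrix_power M k $ j $ i \<le> (M ** matrix_star M) $ j $ i" if "k < CARD('n)" for k
      using that pow[of k j] zero[of j] by (cases "k = 0") auto
    then show ?thesis
      by (simp add: matrix_star_entry[of M j i] semifield_sum_le_iff)
  qed
  then have "M *v v = v"
    using matrix_mult_star_le[OF assms(1)]
    by (simp add: vec_eq_iff Mv antisym) (simp add: v_def antisym)
  moreover have "v \<noteq> 0"
  proof
    assume "v = 0"
    then have "matrix_star M $ i $ i = 0" by (simp add: v_def vec_eq_iff)
    moreover have "matrix_power M 0 $ i $ i \<le> matrix_star M $ i $ i"
      by (rule matrix_power_le_star) simp
    ultimately show False by (simp add: mat_def)
  qed
  ultimately show ?thesis by (auto simp: is_eigenvalue_def)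
qed

text \<open>
  The greatest cycle mean \<open>r\<close>, if nonzero, is an eigenvalue, and hence at most \<open>l\<close>: no cycle of
  \<open>r\<inverse> A\<close> weighs more than \<open>1\<close>, and a cycle whose mean is \<open>r\<close> has weight \<open>1\<close> in \<open>r\<inverse> A\<close>.
\<close>

lemma trace_matrix_power_le_spectral_radius:
  fixes A :: "'a :: radicable_idempotent_semifield ^ 'n ^ 'n"
  assumes "is_spectral_radius A l" and "m \<in> {1..CARD('n)}"
  shows "trace (matrix_power A m) \<le> l ^ m"
proof -
  let ?mean = "\<lambda>m. nth_root m (trace (matrix_power A m))"
  define r where "r = (\<Sum>m = 1..CARD('n). ?mean m)"
  have mean_le: "?mean k \<le> r" if "k \<in> {1..CARD('n)}" for k
    unfolding r_def by (rule semifield_member_le_sum) (use that in auto)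
  have "r \<le> l"
  proof (cases "r = 0")
    case False
    let ?M = "map_matrix ((*) (inverse r)) A"
    have "Tr ?M \<le> 1"
      unfolding Tr_le_iff trace_le_iff
    proof (intro ballI allI)
      fix k i assume k: "k \<in> {1..CARD('n)}"
      then have "trace (matrix_power A k) \<le> r ^ k"
        using mean_le[OF k] nth_root_le_iff[of k "trace (matrix_power A k)" r] by auto
      then show "matrix_power ?M k $ i $ i \<le> 1"
        using False
        by (simp add: scaled_matrix_power semifield_inverse_power_mult_le_iff trace_le_iff)
    qed
    moreover obtain k where k: "k \<in> {1..CARD('n)}" "r = ?mean k"
      using semifield_sum_attained[of "{1..CARD('n)}" ?mean] unfolding r_def by auto
    then have tr: "r ^ k = trace (matrix_power A k)" by (simp add: nth_root_power)
    obtain i where "trace (matrix_power A k) = matrix_power A k $ i $ i"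
      using semifield_sum_attained[of UNIV "\<lambda>i. matrix_power A k $ i $ i"]
      unfolding trace_def by auto
    then have "matrix_power ?M k $ i $ i = (inverse r * r) ^ k"
      using tr by (simp add: scaled_matrix_power power_mult_distrib)
    then have "matrix_power ?M k $ i $ i = 1"
      using semifield_left_inverse[OF False] by simp
    ultimately have "is_eigenvalue ?M 1"
      using k(1) by (intro one_eigenvalue_of_critical_cycle) auto
    then obtain v where v: "v \<noteq> 0" "inverse r *s (A *v v) = v"
      by (auto simp: is_eigenvalue_def scaled_matrix_vector_mult)
    have "r *s v = r *s (inverse r *s (A *v v))" by (simp only: v(2))
    also have "\<dots> = A *v v"
      by (simp only: vec_eq_iff vector_smult_component semifield_inverse_mult_cancel[OF False]) simp
    finally have "is_eigenvalue A r"
      using v(1) by (auto simp: is_eigenvalue_def)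
    then show ?thesis using assms(1) by (simp add: is_spectral_radius_def)
  qed simp
  then show ?thesis
    using mean_le[OF assms(2)] assms(2) nth_root_le_iff[of m "trace (matrix_power A m)" l] by auto
qed


section \<open>Cycles alternating between two matrices\<close>

lemma mixed_product_append:
  "mixed_product A B (is @ js) = mixed_product A B is ** mixed_product A B js"
  by (induction "is") (simp_all add: matrix_mul_assoc)

lemma mixed_product_replicate_0: "mixed_product A B (replicate k 0) = matrix_power A k"
proof (induction k)
  case (Suc k)
  then show ?case by (simp only: replicate_Suc mixed_product.simps matrix_power_Suc_left) simp
qed simp

text \<open>
  The distributive expansion of \<open>(c A + B)\<^sup>m\<close>, reduced by the total order to one dominating word
  for each entry. Factors are split off on the left, which keeps each word in the form
  \<open>B\<^sup>j A B\<^bsup>i\<^sub>1\<^esup> \<dots> A B\<^bsup>i\<^sub>k\<^esup>\<close>: a new \<open>B\<close> increments \<open>j\<close>, and a new \<open>A\<close> turns \<open>j\<close> into the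
  leading exponent.
\<close>

lemma power_of_sum_le_mixed_product:
  fixes A B :: "'a :: radicable_idempotent_semifield ^ 'n ^ 'n"
  shows "\<exists>j is. j + length is + sum_list is = m \<and>
    matrix_power (map_matrix ((*) c) A + B) m $ a $ b
      \<le> c ^ length is * (matrix_power B j ** mixed_product A B is) $ a $ b"
proof (induction m arbitrary: a)
  case 0
  show ?case by (rule exI[of _ 0], rule exI[of _ "[]"]) simp
next
  case (Suc m)
  let ?M = "map_matrix ((*) c) A + B"
  obtain k where k: "(?M ** matrix_power ?M m) $ a $ b = ?M $ a $ k * matrix_power ?M m $ k $ b"
    by (rule matrix_mult_entry_attained)
  obtain j "is" where ji: "j + length is + sum_list is = m"
    and "matrix_power ?M m $ k $ b
      \<le> c ^ length is * (matrix_power B j ** mixed_product A B is) $ k $ b"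
    (is "_ \<le> c ^ _ * ?W $ k $ b")
    using Suc by blast
  then have le: "matrix_power ?M (Suc m) $ a $ b \<le> ?M $ a $ k * (c ^ length is * ?W $ k $ b)"
    unfolding matrix_power_Suc_left k by (intro semifield_mult_left_mono)
  have "?M $ a $ k = max (c * A $ a $ k) (B $ a $ k)"
    by (simp add: semifield_add_eq_max)
  then consider "?M $ a $ k = c * A $ a $ k" | "?M $ a $ k = B $ a $ k"
    unfolding max_def by metis
  then show ?case
  proof cases
    case 1
    have "?M $ a $ k * (c ^ length is * ?W $ k $ b) = c ^ length (j # is) * (A $ a $ k * ?W $ k $ b)"
      unfolding 1 by (simp add: mult_ac)
    also have "\<dots> \<le> c ^ length (j # is) * (A ** ?W) $ a $ b"
      by (intro semifield_mult_left_mono matrix_mult_entry_ge)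
    also have "A ** ?W = matrix_power B 0 ** mixed_product A B (j # is)"
      by (simp add: matrix_mul_assoc)
    finally show ?thesis
      using le ji by (intro exI[of _ 0] exI[of _ "j # is"]) auto
  next
    case 2
    have "?M $ a $ k * (c ^ length is * ?W $ k $ b) = c ^ length is * (B $ a $ k * ?W $ k $ b)"
      unfolding 2 by (simp add: mult_ac)
    also have "\<dots> \<le> c ^ length is * (B ** ?W) $ a $ b"
      by (intro semifield_mult_left_mono matrix_mult_entry_ge)
    also have "B ** ?W = matrix_power B (Suc j) ** mixed_product A B is"
      by (simp only: matrix_power_Suc_left matrix_mul_assoc)
    finally show ?thesis
      using le ji by (intro exI[of _ "Suc j"] exI[of _ "is"]) auto
  qed
qed

lemma trace_rotate_mixed_product:
  fixes A B :: "'a :: comm_semiring_1 ^ 'n ^ 'n"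
  shows "trace (matrix_power B j ** mixed_product A B (is @ [i]))
    = trace (mixed_product A B (is @ [i + j]))"
proof -
  have "trace (matrix_power B j ** mixed_product A B (is @ [i]))
      = trace (mixed_product A B (is @ [i]) ** matrix_power B j)"
    by (rule trace_mul_sym)
  also have "mixed_product A B (is @ [i]) ** matrix_power B j = mixed_product A B (is @ [i + j])"
    by (simp add: mixed_product_append matrix_power_add matrix_mul_assoc)
  finally show ?thesis .
qed

text \<open>
  The definition of \<open>\<theta>\<close> omits the tuples of zeros, for which the product is a power of \<open>A\<close>; these
  are controlled by the spectral radius.
\<close>

lemma trace_mixed_product_le_theta:
  fixes A B :: "'a :: radicable_idempotent_semifield ^ 'n ^ 'n"
  assumes "is_spectral_radius A l"
    and "is \<noteq> []" "length is + sum_list is \<le> CARD('n)"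
  shows "trace (mixed_product A B is) \<le> theta l A B ^ length is"
proof (cases "sum_list is = 0")
  case True
  then have "is = replicate (length is) 0"
    by (intro replicate_eqI) (auto simp: sum_list_eq_0_iff)
  then have "mixed_product A B is = matrix_power A (length is)"
    by (metis mixed_product_replicate_0)
  moreover have "trace (matrix_power A (length is)) \<le> l ^ length is"
    using assms by (intro trace_matrix_power_le_spectral_radius) (auto simp: Suc_le_eq)
  moreover have "l ^ length is \<le> theta l A B ^ length is"
    by (rule semifield_power_mono) (simp add: theta_def semifield_add_eq_max)
  ultimately show ?thesis by simp
next
  case False
  let ?k = "length is"
    and ?root = "\<lambda>k is. nth_root k (trace (mixed_product A B is))"
  from False have "1 \<le> sum_list is" by linarith
  moreover have "1 \<le> ?k" using assms(2) by (simp add: Suc_le_eq)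
  ultimately have mem: "is \<in> exponent_tuples CARD('n) ?k" and k: "?k \<in> {1..CARD('n) - 1}"
    using assms(3) unfolding exponent_tuples_def mem_Collect_eq atLeastAtMost_iff by linarith+
  have "?root ?k is \<le> (\<Sum>is \<in> exponent_tuples CARD('n) ?k. ?root ?k is)"
    by (rule semifield_member_le_sum[OF finite_exponent_tuples mem])
  also have "\<dots> \<le> (\<Sum>k = 1..CARD('n) - 1. \<Sum>is \<in> exponent_tuples CARD('n) k. ?root k is)"
    by (rule semifield_member_le_sum[OF _ k]) simp
  also have "\<dots> \<le> theta l A B"
    by (simp add: theta_def semifield_add_eq_max)
  finally show ?thesis
    using assms(2) by (simp add: nth_root_le_iff)
qed

text \<open>
  With \<open>k\<close> the number of factors \<open>A\<close> in its dominating word, a diagonal entry of the \<open>m\<close>-th power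
  is at most \<open>(\<theta>\<inverse>)\<^sup>k\<close> times the trace of that word. Moving the leading
  power of \<open>B\<close> to the end of the word turns it into a product whose trace is at most \<open>\<theta>\<^sup>k\<close>; a
  word without \<open>A\<close> is a power of \<open>B\<close>.
\<close>

lemma Tr_scaled_sum_le_one:
  fixes A B :: "'a :: radicable_idempotent_semifield ^ 'n ^ 'n"
  assumes "is_spectral_radius A l" "0 < l" "Tr B \<le> 1"
  shows "Tr (map_matrix ((*) (inverse (theta l A B))) A + B) \<le> 1"
  unfolding Tr_le_iff trace_le_iff
proof (intro ballI allI)
  fix m and a :: 'n
  assume m: "m \<in> {1..CARD('n)}"
  let ?\<theta> = "theta l A B"
  have \<theta>: "?\<theta> \<noteq> 0"
    using assms(2) by (auto simp: theta_def)
  obtain j "is" where ji: "j + length is + sum_list is = m"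
    and le: "matrix_power (map_matrix ((*) (inverse ?\<theta>)) A + B) m $ a $ a
      \<le> inverse ?\<theta> ^ length is * (matrix_power B j ** mixed_product A B is) $ a $ a"
    using power_of_sum_le_mixed_product by blast
  have "trace (matrix_power B j ** mixed_product A B is) \<le> ?\<theta> ^ length is"
  proof (cases "is" rule: rev_cases)
    case Nil
    then show ?thesis using ji m assms(3) by (auto simp: Tr_le_iff)
  next
    case (snoc js i)
    then show ?thesis
      using trace_mixed_product_le_theta[OF assms(1), of "js @ [i + j]" B] ji m
      by (simp add: trace_rotate_mixed_product)
  qed
  then have "inverse ?\<theta> ^ length is * (matrix_power B j ** mixed_product A B is) $ a $ a \<le> 1"
    using \<theta> by (simp add: semifield_inverse_power_mult_le_iff trace_le_iff)
  with le show "matrix_power (map_matrix ((*) (inverse ?\<theta>)) A + B) m $ a $ a \<le> 1"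
    by (rule order_trans)
qed

lemma mixed_product_vector_le:
  fixes A B :: "'a :: radicable_idempotent_semifield ^ 'n ^ 'n"
  assumes "A *v x \<le> c *s x" "B *v x \<le> x"
  shows "mixed_product A B is *v x \<le> c ^ length is *s x"
proof (induction "is")
  case (Cons i "is")
  let ?d = "c ^ length is"
  have "mixed_product A B (i # is) *v x = A *v (matrix_power B i *v (mixed_product A B is *v x))"
    by (simp add: matrix_vector_mul_assoc matrix_mul_assoc)
  also have "\<dots> \<le> A *v (matrix_power B i *v (?d *s x))"
    by (intro matrix_vector_mult_mono Cons)
  also have "\<dots> = ?d *s (A *v (matrix_power B i *v x))"
    by (simp only: matrix_vector_smult)
  also have "\<dots> \<le> ?d *s (A *v x)"
    using matrix_vector_mult_mono[OF matrix_power_vector_le[OF assms(2)], of A i]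
    by (simp add: less_eq_vec_def semifield_mult_left_mono)
  also have "\<dots> \<le> c ^ length (i # is) *s x"
    using assms(1) semifield_mult_left_mono[of "(A *v x) $ _" "c * x $ _" ?d]
    by (simp add: less_eq_vec_def mult_ac)
  finally show ?case .
qed (simp add: less_eq_vec_def)

lemma theta_le_of_subeigenvector:
  fixes A B :: "'a :: radicable_idempotent_semifield ^ 'n ^ 'n"
  assumes "is_spectral_radius A l"
    and "regular_vec x" "A *v x \<le> c *s x" "B *v x \<le> x"
  shows "theta l A B \<le> c"
proof -
  have "l \<le> c"
    using assms eigenvalue_le_of_subeigenvector by (auto simp: is_spectral_radius_def)
  moreover have "nth_root k (trace (mixed_product A B is)) \<le> c"
    if "k \<in> {1..CARD('n) - 1}" "is \<in> exponent_tuples CARD('n) k" for k "is"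
    using trace_le_of_subeigenvector[OF assms(2) mixed_product_vector_le[OF assms(3,4)], of "is"] that
    by (auto simp: nth_root_le_iff exponent_tuples_def)
  ultimately show ?thesis
    unfolding theta_def semifield_add_le_iff
    by (auto simp: semifield_sum_le_iff finite_exponent_tuples)
qed


section \<open>The optimization problem\<close>

lemma objective_le_iff:
  fixes A :: "'a :: radicable_idempotent_semifield ^ 'n ^ 'n"
  assumes "regular_vec x"
  shows "objective A p x \<le> c \<longleftrightarrow> A *v x \<le> c *s x \<and> p \<le> c *s x"
proof -
  have x: "x $ i \<noteq> 0" for i using assms by (simp add: regular_vec_def)
  have "scalar_product (conj_transpose x) y \<le> c \<longleftrightarrow> y \<le> c *s x" for y
    using x by (simp add: scalar_product_def conj_transpose_def semifield_sum_le_iff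
        semifield_inverse_mult_le_iff less_eq_vec_def mult.commute[of c])
  then show ?thesis by (simp add: objective_def semifield_add_le_iff)
qed

text \<open>
  This merges the constraint and a bound on the objective into one system of the form
  \<open>M x \<le> x\<close>, \<open>b \<le> x\<close>, to which the star applies.
\<close>

lemma feasible_objective_le_iff:
  fixes A B :: "'a :: radicable_idempotent_semifield ^ 'n ^ 'n"
  assumes "c \<noteq> 0" "regular_vec x"
  shows "feasible B g x \<and> objective A p x \<le> c \<longleftrightarrow>
    (map_matrix ((*) (inverse c)) A + B) *v x \<le> x \<and> inverse c *s p + g \<le> x"
  using assms
  by (auto simp: feasible_def objective_le_iff matrix_vector_mult_add_rdistrib
      scaled_matrix_vector_mult less_eq_vec_def semifield_add_le_iff semifield_inverse_mult_le_iff)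

theorem theorem8:
  fixes A B :: "'a :: radicable_idempotent_semifield ^ 'n ^ 'n"
    and p g :: "'a ^ 'n"
    and l \<theta> :: 'a
  assumes "is_spectral_radius A l" and "0 < l"
    and "Tr B \<le> 1"
    and "\<theta> = theta l A B"
  shows "(\<exists>x. feasible B g x \<and> objective A p x = \<theta>) \<and>
         (\<forall>x. feasible B g x \<longrightarrow> \<theta> \<le> objective A p x) \<and>
         (\<forall>x. regular_vec x \<longrightarrow>
            (is_arg_min (objective A p) (feasible B g) x \<longleftrightarrow>
             (\<exists>u. inverse \<theta> *s p + g \<le> u \<and>
                  x = matrix_star (map_matrix ((*) (inverse \<theta>)) A + B) *v u)))"
proof -
  let ?M = "map_matrix ((*) (inverse \<theta>)) A + B" and ?b = "inverse \<theta> *s p + g"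
  have \<theta>: "\<theta> \<noteq> 0" using assms(2,4) by (auto simp: theta_def)
  have lower: "\<theta> \<le> objective A p x" if "feasible B g x" for x
  proof -
    have x: "regular_vec x" "B *v x \<le> x"
      using that by (auto simp: feasible_def less_eq_vec_def semifield_add_le_iff)
    then show ?thesis
      using objective_le_iff[OF x(1), of A p "objective A p x"] assms(1,4)
        theta_le_of_subeigenvector by blast
  qed
  have solution: "feasible B g x \<and> objective A p x \<le> \<theta> \<longleftrightarrow>
      (\<exists>u. ?b \<le> u \<and> x = matrix_star ?M *v u)" if "regular_vec x" for x
    unfolding feasible_objective_le_iff[OF \<theta> that]
    by (rule subinvariant_iff_star_image) (simp add: assms Tr_scaled_sum_le_one)
  \<comment> \<open>A solution needs a regular parameter; adding \<open>1\<close> to each entry of \<open>?b\<close> removes its zeros.\<close>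
  let ?u = "\<chi> i. 1 + ?b $ i"
  have "regular_vec (matrix_star ?M *v ?u)"
  proof -
    have "1 \<le> (matrix_star ?M *v ?u) $ i" for i
      using le_matrix_star_vector[of ?u ?M] by (simp add: less_eq_vec_def semifield_add_le_iff)
    then show ?thesis unfolding regular_vec_def by (metis le_zero_eq zero_neq_one)
  qed
  moreover have "?b \<le> ?u" by (simp add: less_eq_vec_def semifield_add_eq_max)
  ultimately obtain x where x: "feasible B g x" "objective A p x \<le> \<theta>"
    using solution by blast
  then have attained: "objective A p x = \<theta>" using lower by (simp add: antisym)
  have "is_arg_min (objective A p) (feasible B g) y \<longleftrightarrow> feasible B g y \<and> objective A p y \<le> \<theta>" for y
    unfolding is_arg_min_linorder using x lower by (auto intro: order_trans)
  then show ?thesis using x attained lower solution by auto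
qed

end
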